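(* (Soundness of access Hoare logic.) For every program $C$ of the while language and all assertions $P,Q$: if $\langle P\rangle\,C\,\langle Q\rangle$ is provable in access Hoare logic, then $\langle P\rangle\,C\,\langle Q\rangle$ is valid.
   Context: States are mappings from variables to values; assertions are predicates on states. Programs of the while language are built from $\mathtt{skip}$, assignments $V:=E$ ($V$ a variable, $E$ a side-effect-free expression possibly containing $V$), sequential composition $S;T$, $\mathtt{if}\ B\ \mathtt{then}\ S\ \mathtt{else}\ T$ and $\mathtt{while}\ B\ \mathtt{do}\ S$ ($B$ a boolean condition), with the standard deterministic big-step execution relation $C:s\Rightarrow s'$. The access Hoare triple $\langle P\rangle\,C\,\langle Q\rangle$ is valid iff $\forall s,s'\,[\,C:s\Rightarrow s'\wedge Q(s')\rightarrow P(s)\,]$. Access Hoare logic is the calculus with the following axioms and rules: (skip) $\langle P\rangle\,\mathtt{skip}\,\langle P\rangle$; (assignment) $\langle P[E/V]\rangle\,V:=E\,\langle P\rangle$, where $P[E/V]$ replaces free occurrences of $V$ in $P$ by $E$; (consequence) from $P_2\rightarrow P_1$ (valid implication), $\langle P_2\rangle\,S\,\langle Q_2\rangle$ and $Q_1\rightarrow Q_2$ (valid implication) infer $\langle P_1\rangle\,S\,\langle Q_1\rangle$; (composition) from $\langle P\rangle\,S\,\langle R\rangle$ and $\langle R\rangle\,T\,\langle Q\rangle$ infer $\langle P\rangle\,S;T\,\langle Q\rangle$; (conditional) from $\langle B\rightarrow P\rangle\,S\,\langle Q\rangle$ and $\langle \neg B\rightarrow P\rangle\,T\,\langle Q\rangle$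 infer $\langle P\rangle\,\mathtt{if}\ B\ \mathtt{then}\ S\ \mathtt{else}\ T\,\langle Q\rangle$; (while) from $\langle B\rightarrow P\rangle\,S\,\langle P\rangle$ infer $\langle P\rangle\,\mathtt{while}\ B\ \mathtt{do}\ S\,\langle \neg B\rightarrow P\rangle$. *)

theory Defs
  imports Main
begin

type_synonym ('v, 'a) state = "'v \<Rightarrow> 'a"
type_synonym ('v, 'a) assn = "('v, 'a) state \<Rightarrow> bool"

text \<open>Expressions and conditions are represented by their denotations; evaluation cannot
  change the state, so they are side-effect free. The types of variables and values are arbitrary.\<close>

type_synonym ('v, 'a) expr = "('v, 'a) state \<Rightarrow> 'a"
type_synonym ('v, 'a) bexpr = "('v, 'a) state \<Rightarrow> bool"

datatype ('v, 'a) com =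
    SKIP
  | Assign 'v "('v, 'a) expr"  (\<open>_ ::= _\<close> [1000, 61] 61)
  | Seq "('v, 'a) com" "('v, 'a) com"  (\<open>_;;/ _\<close> [60, 61] 60)
  | If "('v, 'a) bexpr" "('v, 'a) com" "('v, 'a) com"
      (\<open>(IF _/ THEN _/ ELSE _)\<close> [0, 0, 61] 61)
  | While "('v, 'a) bexpr" "('v, 'a) com"  (\<open>(WHILE _/ DO _)\<close> [0, 61] 61)

inductive big_step :: "('v, 'a) com \<Rightarrow> ('v, 'a) state \<Rightarrow> ('v, 'a) state \<Rightarrow> bool"
where
  Skip: "big_step SKIP s s"
| Assign: "big_step (V ::= E) s (s(V := E s))"
| Seq: "\<lbrakk>big_step S s t; big_step T t u\<rbrakk> \<Longrightarrow> big_step (S ;; T) s u"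
| IfTrue: "\<lbrakk>B s; big_step S s t\<rbrakk> \<Longrightarrow> big_step (IF B THEN S ELSE T) s t"
| IfFalse: "\<lbrakk>\<not> B s; big_step T s t\<rbrakk> \<Longrightarrow> big_step (IF B THEN S ELSE T) s t"
| WhileFalse: "\<not> B s \<Longrightarrow> big_step (WHILE B DO S) s s"
| WhileTrue: "\<lbrakk>B s; big_step S s t; big_step (WHILE B DO S) t u\<rbrakk>
    \<Longrightarrow> big_step (WHILE B DO S) s u"

definition access_valid :: "('v, 'a) assn \<Rightarrow> ('v, 'a) com \<Rightarrow> ('v, 'a) assn \<Rightarrow> bool"
where
  "access_valid P C Q \<longleftrightarrow> (\<forall>s s'. big_step C s s' \<and> Q s' \<longrightarrow> P s)"

text \<open>Substitution of \<open>E\<close> for \<open>V\<close> in a predicate on states: evaluate the predicate in the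
  state where \<open>V\<close> holds the value of \<open>E\<close>.\<close>

definition assn_subst :: "('v, 'a) assn \<Rightarrow> ('v, 'a) expr \<Rightarrow> 'v \<Rightarrow> ('v, 'a) assn"
where
  "assn_subst P E V = (\<lambda>s. P (s(V := E s)))"

inductive access_provable :: "('v, 'a) assn \<Rightarrow> ('v, 'a) com \<Rightarrow> ('v, 'a) assn \<Rightarrow> bool"
where
  Skip: "access_provable P SKIP P"
| Assign: "access_provable (assn_subst P E V) (V ::= E) P"
| Conseq: "\<lbrakk>\<forall>s. P2 s \<longrightarrow> P1 s; access_provable P2 S Q2; \<forall>s. Q1 s \<longrightarrow> Q2 s\<rbrakk>
    \<Longrightarrow> access_provable P1 S Q1"
| Seq: "\<lbrakk>access_provable P S R; access_provable R T Q\<rbrakk> \<Longrightarrow> access_provable P (S ;; T) Q"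
| If: "\<lbrakk>access_provable (\<lambda>s. B s \<longrightarrow> P s) S Q; access_provable (\<lambda>s. \<not> B s \<longrightarrow> P s) T Q\<rbrakk>
    \<Longrightarrow> access_provable P (IF B THEN S ELSE T) Q"
| While: "access_provable (\<lambda>s. B s \<longrightarrow> P s) S P
    \<Longrightarrow> access_provable P (WHILE B DO S) (\<lambda>s. \<not> B s \<longrightarrow> P s)"

end

theory Submission
  imports Defs
begin

text \<open>Validity says that the precondition is necessary for reaching the postcondition, so each
  rule only has to pull truth backwards along an execution. This goes by induction on the
  derivation; only the loop needs a second induction, on its execution, done in
  \<open>while_access\<close>.\<close>

inductive_cases SkipE: "big_step SKIP s t"
inductive_cases AssignE: "big_step (V ::= E) s t"
inductive_cases SeqE: "big_step (S ;; T) s t"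
inductive_cases IfE: "big_step (IF B THEN S ELSE T) s t"

text \<open>\<open>P\<close> is an invariant read backwards: it holds at exit, where
  \<open>B\<close> is false, and each pass of the body carries it back to the state before.\<close>

lemma while_access:
  assumes body: "access_valid (\<lambda>s. B s \<longrightarrow> P s) S P"
    and "big_step (WHILE B DO S) s t" and "\<not> B t \<longrightarrow> P t"
  shows "P s"
  using assms(2,3)
proof (induction "WHILE B DO S" s t rule: big_step.induct)
  case (WhileFalse s)
  then show ?case by simp
next
  \<comment> \<open>The induction hypothesis gives \<open>P t\<close>; \<open>body\<close> turns it
    into \<open>P s\<close> because \<open>B s\<close> holds.\<close>
  case (WhileTrue s t u)
  then show ?case using body unfolding access_valid_def by blast
qed

theorem theorem6p1:
  fixes C :: "('v, 'a) com" and P Q :: "('v, 'a) assn"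
  assumes "access_provable P C Q"
  shows "access_valid P C Q"
  using assms
proof (induction rule: access_provable.induct)
  case (Skip P)
  show ?case by (auto simp: access_valid_def elim: SkipE)
next
  case (Assign P E V)
  show ?case by (auto simp: access_valid_def assn_subst_def elim: AssignE)
next
  case (Conseq P2 P1 S Q2 Q1)
  then show ?case unfolding access_valid_def by blast
next
  case (Seq P S R T Q)
  then show ?case unfolding access_valid_def by (blast elim: SeqE)
next
  case (If B P S Q T)
  then show ?case unfolding access_valid_def by (blast elim: IfE)
next
  case (While B P S)
  then show ?case using while_access unfolding access_valid_def[of P "WHILE B DO S"] by blast
qed

end
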